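(* Let $X$ be a nonzero complex Banach space such that $X$ or its dual $X^*$ is complex strictly convex. Let $A : X \to X$ be a closed densely defined linear operator with a compact resolvent $R(\lambda) := (A-\lambda I)^{-1}$. Let $\Omega$ be an open subset of the resolvent set of $A$, and let $M$ be a real number. If $\|R(\lambda)\| \le M$ for all $\lambda \in \Omega$, then $\|R(\lambda)\| < M$ for all $\lambda \in \Omega$.
   Context: A complex Banach space $Y$ is called complex strictly convex if the following holds: whenever $x, y \in Y$, $\|x\| = 1$ and $\|x + \zeta y\| \le 1$ for all $\zeta \in \mathbb{C}$ with $|\zeta| \le 1$, then $y = 0$. A closed densely defined operator $A : X \to X$ means a (possibly unbounded) closed linear operator with dense domain $\mathrm{Dom}(A) \subseteq X$ and values in $X$. It has a compact resolvent if its resolvent set is nonempty and $(A-\lambda I)^{-1} : X \to X$ is a compact operator for every (equivalently, for some) $\lambda$ in the resolvent set. *)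

theory Defs
  imports "HOL-Analysis.Analysis"
begin

class scaleC =
  fixes scaleC :: "complex \<Rightarrow> 'a \<Rightarrow> 'a" (infixr \<open>*\<^sub>C\<close> 75)

text \<open>The real structure is the restriction of the complex one, so that the real-analytic library
  (topology, \<^const>\<open>bounded_linear\<close>, \<^const>\<open>onorm\<close>) applies to complex spaces.\<close>

class complex_normed_vector = real_normed_vector + scaleC +
  assumes scaleC_add_right: "a *\<^sub>C (x + y) = a *\<^sub>C x + a *\<^sub>C y"
    and scaleC_add_left: "(a + b) *\<^sub>C x = a *\<^sub>C x + b *\<^sub>C x"
    and scaleC_scaleC [simp]: "a *\<^sub>C (b *\<^sub>C x) = (a * b) *\<^sub>C x"
    and scaleC_one [simp]: "1 *\<^sub>C x = x"
    and scaleR_eq_scaleC: "r *\<^sub>R x = complex_of_real r *\<^sub>C x"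
    and norm_scaleC [simp]: "norm (a *\<^sub>C x) = cmod a * norm x"

class complex_banach = complex_normed_vector + banach

global_interpretation complex_vector:
  vector_space "scaleC :: complex \<Rightarrow> 'a \<Rightarrow> 'a::complex_normed_vector"
  defines csubspace = complex_vector.subspace
  by standard (simp_all add: scaleC_add_right scaleC_add_left)

instantiation complex :: complex_banach
begin

definition scaleC_complex :: "complex \<Rightarrow> complex \<Rightarrow> complex"
  where [simp]: "scaleC_complex a x = a * x"

instance
  by standard (simp_all add: algebra_simps norm_mult scaleR_conv_of_real)

end

definition bounded_clinear :: "('a::complex_normed_vector \<Rightarrow> 'b::complex_normed_vector) \<Rightarrow> bool"
  where "bounded_clinear f \<longleftrightarrow> bounded_linear f \<and> (\<forall>c x. f (c *\<^sub>C x) = c *\<^sub>C f x)"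

typedef (overloaded) 'a cdual =
  "{f :: 'a::complex_normed_vector \<Rightarrow>\<^sub>L complex. bounded_clinear (blinfun_apply f)}"
  morphisms blinfun_of_cdual Cdual
  by (rule exI[of _ 0]) (simp add: bounded_clinear_def blinfun.bounded_linear_right)

setup_lifting type_definition_cdual

instantiation cdual :: (complex_normed_vector) complex_normed_vector
begin

lift_definition zero_cdual :: "'a cdual" is 0
  by (simp add: bounded_clinear_def blinfun.bounded_linear_right)

lift_definition plus_cdual :: "'a cdual \<Rightarrow> 'a cdual \<Rightarrow> 'a cdual" is "(+)"
  by (simp add: bounded_clinear_def blinfun.bounded_linear_right blinfun.add_left algebra_simps)

lift_definition minus_cdual :: "'a cdual \<Rightarrow> 'a cdual \<Rightarrow> 'a cdual" is "(-)"
  by (simp add: bounded_clinear_def blinfun.bounded_linear_right blinfun.diff_left algebra_simps)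

lift_definition uminus_cdual :: "'a cdual \<Rightarrow> 'a cdual" is uminus
  by (simp add: bounded_clinear_def blinfun.bounded_linear_right blinfun.minus_left)

lift_definition scaleR_cdual :: "real \<Rightarrow> 'a cdual \<Rightarrow> 'a cdual" is "scaleR"
  by (simp add: bounded_clinear_def blinfun.bounded_linear_right blinfun.scaleR_left)

lift_definition scaleC_cdual :: "complex \<Rightarrow> 'a cdual \<Rightarrow> 'a cdual"
  is "\<lambda>c f. Blinfun (\<lambda>x. c * blinfun_apply f x)"
  by (auto simp: bounded_clinear_def bounded_linear_Blinfun_apply bounded_linear_intros)

lift_definition norm_cdual :: "'a cdual \<Rightarrow> real" is norm .

definition dist_cdual :: "'a cdual \<Rightarrow> 'a cdual \<Rightarrow> real"
  where "dist_cdual f g = norm (f - g)"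

definition sgn_cdual :: "'a cdual \<Rightarrow> 'a cdual"
  where "sgn_cdual f = inverse (norm f) *\<^sub>R f"

definition uniformity_cdual :: "('a cdual \<times> 'a cdual) filter"
  where "uniformity_cdual = (INF e\<in>{0 <..}. principal {(f, g). dist f g < e})"

definition open_cdual :: "'a cdual set \<Rightarrow> bool"
  where "open_cdual S \<longleftrightarrow> (\<forall>f\<in>S. \<forall>\<^sub>F (f', g) in uniformity. f' = f \<longrightarrow> g \<in> S)"

instance
proof
  have ap: "blinfun_apply (Blinfun (\<lambda>x. c * blinfun_apply f x)) = (\<lambda>x. c * blinfun_apply f x)"
    for c and f :: "'a \<Rightarrow>\<^sub>L complex"
    by (simp add: bounded_linear_Blinfun_apply bounded_linear_intros)
  have eqI: "u = v \<longleftrightarrow>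
      (\<forall>x. blinfun_apply (blinfun_of_cdual u) x = blinfun_apply (blinfun_of_cdual v) x)"
    for u v :: "'a cdual"
    by (metis blinfun_eqI blinfun_of_cdual_inject)
  have app: "blinfun_apply (blinfun_of_cdual (u + v)) x
      = blinfun_apply (blinfun_of_cdual u) x + blinfun_apply (blinfun_of_cdual v) x"
    "blinfun_apply (blinfun_of_cdual (r *\<^sub>R u)) x = r *\<^sub>R blinfun_apply (blinfun_of_cdual u) x"
    "blinfun_apply (blinfun_of_cdual (c *\<^sub>C u)) x = c * blinfun_apply (blinfun_of_cdual u) x"
    for u v :: "'a cdual" and r c x
    by (simp_all only: plus_cdual.rep_eq scaleR_cdual.rep_eq scaleC_cdual.rep_eq ap
        blinfun.add_left blinfun.scaleR_left)
  fix f g h :: "'a cdual" and r s :: real and a b :: complex and S :: "'a cdual set"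
  show "f + g + h = f + (g + h)" "f + g = g + f" "0 + f = f" "- f + f = 0" "f - g = f + - g"
    by (transfer, simp)+
  show "r *\<^sub>R (f + g) = r *\<^sub>R f + r *\<^sub>R g" "(r + s) *\<^sub>R f = r *\<^sub>R f + s *\<^sub>R f"
    "r *\<^sub>R s *\<^sub>R f = (r * s) *\<^sub>R f" "1 *\<^sub>R f = f"
    by (transfer, simp add: scaleR_add_right scaleR_add_left)+
  show "dist f g = norm (f - g)" "sgn f = inverse (norm f) *\<^sub>R f"
    by (simp_all add: dist_cdual_def sgn_cdual_def)
  show "(uniformity :: ('a cdual \<times> 'a cdual) filter)
      = (INF e\<in>{0 <..}. principal {(f, g). dist f g < e})"
    by (rule uniformity_cdual_def)
  show "open S \<longleftrightarrow> (\<forall>f\<in>S. \<forall>\<^sub>F (f', g) in uniformity. f' = f \<longrightarrow> g \<in> S)"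
    by (rule open_cdual_def)
  show "norm f = 0 \<longleftrightarrow> f = 0" "norm (r *\<^sub>R f) = \<bar>r\<bar> * norm f"
    by (transfer, simp)+
  show "norm (f + g) \<le> norm f + norm g"
    by transfer (rule norm_triangle_ineq)
  show "a *\<^sub>C (f + g) = a *\<^sub>C f + a *\<^sub>C g" "(a + b) *\<^sub>C f = a *\<^sub>C f + b *\<^sub>C f"
    "a *\<^sub>C b *\<^sub>C f = (a * b) *\<^sub>C f" "1 *\<^sub>C f = f"
    by (simp_all only: eqI app distrib_left distrib_right mult.assoc mult_1_left simp_thms)
  show "r *\<^sub>R f = complex_of_real r *\<^sub>C f"
    by (simp only: eqI app scaleR_conv_of_real simp_thms)
  have le: "norm (Blinfun (\<lambda>x. c * blinfun_apply f x)) \<le> cmod c * norm f"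
    for c and f :: "'a \<Rightarrow>\<^sub>L complex"
  proof (rule norm_blinfun_bound)
    fix x
    show "norm (blinfun_apply (Blinfun (\<lambda>x. c * blinfun_apply f x)) x) \<le> cmod c * norm f * norm x"
      using mult_left_mono[OF norm_blinfun[of f x], of "cmod c"]
      by (simp add: ap norm_mult mult.assoc)
  qed simp
  have "norm (Blinfun (\<lambda>x. c * blinfun_apply f x)) = cmod c * norm f"
    for c and f :: "'a \<Rightarrow>\<^sub>L complex"
  proof (cases "c = 0")
    case True
    then show ?thesis using le[of c f] by simp
  next
    case False
    have eq: "Blinfun (\<lambda>x. inverse c * blinfun_apply (Blinfun (\<lambda>x. c * blinfun_apply f x)) x) = f"
      using False
      by (simp only: ap mult.assoc[symmetric] left_inverse mult_1_left not_False_eq_True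
          blinfun_apply_inverse)
    have "norm f \<le> cmod (inverse c) * norm (Blinfun (\<lambda>x. c * blinfun_apply f x))"
      using le[of "inverse c" "Blinfun (\<lambda>x. c * blinfun_apply f x)"] by (simp only: eq)
    then have "cmod c * norm f \<le> norm (Blinfun (\<lambda>x. c * blinfun_apply f x))"
      using False by (simp add: norm_inverse norm_divide field_simps)
    then show ?thesis using le[of c f] by simp
  qed
  then show "norm (a *\<^sub>C f) = cmod a * norm f"
    by transfer
qed

end

instance cdual :: (complex_normed_vector) complex_banach
proof
  fix X :: "nat \<Rightarrow> 'a cdual"
  assume X: "Cauchy X"
  have d: "dist (blinfun_of_cdual f) (blinfun_of_cdual g) = dist f g" for f g :: "'a cdual"
    by (simp add: dist_norm norm_cdual.rep_eq minus_cdual.rep_eq)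
  have "Cauchy (\<lambda>n. blinfun_of_cdual (X n))"
    using X by (simp add: Cauchy_def d)
  then obtain L where L: "(\<lambda>n. blinfun_of_cdual (X n)) \<longlonglongrightarrow> L"
    by (auto simp: Cauchy_convergent_iff convergent_def)
  have Lx: "(\<lambda>n. blinfun_apply (blinfun_of_cdual (X n)) x) \<longlonglongrightarrow> blinfun_apply L x" for x
    using L by (intro tendsto_intros)
  have "blinfun_apply L (c *\<^sub>C x) = c *\<^sub>C blinfun_apply L x" for c x
  proof (rule LIMSEQ_unique[OF Lx])
    have "blinfun_apply (blinfun_of_cdual (X n)) (c *\<^sub>C x)
        = c * blinfun_apply (blinfun_of_cdual (X n)) x" for n
      using blinfun_of_cdual[of "X n"] by (simp add: bounded_clinear_def)
    then show "(\<lambda>n. blinfun_apply (blinfun_of_cdual (X n)) (c *\<^sub>C x))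
        \<longlonglongrightarrow> c *\<^sub>C blinfun_apply L x"
      using tendsto_mult_left[OF Lx[of x], of c] by simp
  qed
  then have "blinfun_of_cdual (Cdual L) = L"
    by (intro Cdual_inverse) (simp add: bounded_clinear_def blinfun.bounded_linear_right)
  then have "X \<longlonglongrightarrow> Cdual L"
    using L d[of _ "Cdual L"] by (simp add: lim_sequentially)
  then show "convergent X"
    by (auto simp: convergent_def)
qed

definition complex_strictly_convex :: "'a::complex_banach itself \<Rightarrow> bool"
  where "complex_strictly_convex _ \<longleftrightarrow>
    (\<forall>x y :: 'a. norm x = 1 \<longrightarrow> (\<forall>\<zeta>. cmod \<zeta> \<le> 1 \<longrightarrow> norm (x + \<zeta> *\<^sub>C y) \<le> 1) \<longrightarrow> y = 0)"

text \<open>A possibly unbounded operator is given by its domain \<open>D\<close> and a function \<open>A\<close> whose values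
  outside \<open>D\<close> are irrelevant.\<close>

definition clinear_operator :: "'a::complex_normed_vector set \<Rightarrow> ('a \<Rightarrow> 'a) \<Rightarrow> bool"
  where "clinear_operator D A \<longleftrightarrow> csubspace D \<and>
    (\<forall>x\<in>D. \<forall>y\<in>D. A (x + y) = A x + A y) \<and> (\<forall>c. \<forall>x\<in>D. A (c *\<^sub>C x) = c *\<^sub>C A x)"

definition closed_operator :: "'a::complex_normed_vector set \<Rightarrow> ('a \<Rightarrow> 'a) \<Rightarrow> bool"
  where "closed_operator D A \<longleftrightarrow> clinear_operator D A \<and> closed ((\<lambda>x. (x, A x)) ` D)"

definition densely_defined :: "'a::complex_normed_vector set \<Rightarrow> bool"
  where "densely_defined D \<longleftrightarrow> closure D = UNIV"

definition resolvent ::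
    "'a::complex_normed_vector set \<Rightarrow> ('a \<Rightarrow> 'a) \<Rightarrow> complex \<Rightarrow> 'a \<Rightarrow> 'a"
  where "resolvent D A z = inv_into D (\<lambda>x. A x - z *\<^sub>C x)"

definition resolvent_set :: "'a::complex_normed_vector set \<Rightarrow> ('a \<Rightarrow> 'a) \<Rightarrow> complex set"
  where "resolvent_set D A =
    {z. bij_betw (\<lambda>x. A x - z *\<^sub>C x) D UNIV \<and> bounded_clinear (resolvent D A z)}"

definition compact_operator :: "('a::complex_normed_vector \<Rightarrow> 'b::complex_normed_vector) \<Rightarrow> bool"
  where "compact_operator T \<longleftrightarrow> bounded_clinear T \<and> compact (closure (T ` cball 0 1))"

definition has_compact_resolvent :: "'a::complex_normed_vector set \<Rightarrow> ('a \<Rightarrow> 'a) \<Rightarrow> bool"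
  where "has_compact_resolvent D A \<longleftrightarrow> resolvent_set D A \<noteq> {} \<and>
    (\<forall>z\<in>resolvent_set D A. compact_operator (resolvent D A z))"

end

theory Submission
  imports Defs
begin

text \<open>Suppose \<open>\<parallel>R(z)\<parallel> \<le> M\<close> near \<open>\<lambda>\<close> and put \<open>T = R(\<lambda>)\<close>. Averaging the Neumann series
  \<open>R(\<lambda> + z) = T + z T\<^sup>2 + \<dots>\<close> over a small circle with the nonnegative weight
  \<open>1 + cos \<theta>\<close> shows \<open>\<parallel>T x + w T\<^sup>2 x\<parallel> \<le> M \<parallel>x\<parallel>\<close> for all small \<open>w\<close>. If \<open>\<parallel>T\<parallel> = M\<close>, then by compactness
  there is a limit \<open>y\<close> of points of the image of the unit ball with \<open>\<parallel>y\<parallel> = M\<close>, and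
  \<open>\<parallel>y + w T y\<parallel> \<le> M\<close>. If \<open>X\<close> is complex strictly convex, this forces \<open>T y = 0\<close>, which contradicts
  injectivity. If \<open>X\<^sup>*\<close> is, one applies the same reasoning to \<open>f \<circ> T\<close> for a functional \<open>f\<close> norming
  \<open>y\<close>: this gives \<open>f \<circ> T\<^sup>2 = 0\<close>, hence \<open>f = 0\<close> because \<open>T\<close> has dense range.\<close>

subsection \<open>Averages over roots of unity\<close>

lemma bounded_linear_scaleC: "bounded_linear (scaleC a :: 'a::complex_normed_vector \<Rightarrow> 'a)"
proof (rule bounded_linear_intro[where K="cmod a"])
  show "a *\<^sub>C (r *\<^sub>R x) = r *\<^sub>R a *\<^sub>C x" for r and x :: 'a
    by (simp add: scaleR_eq_scaleC mult.commute)
qed (simp_all add: scaleC_add_right mult.commute)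

text \<open>A geometric sum whose ratio is an \<open>N\<close>-th root of unity; the ratio differs
  from 1 because \<open>N\<close> cannot divide \<open>m\<close> when
  \<open>0 < m < N\<close>.\<close>

lemma sum_cis_roots_of_unity:
  assumes "0 < m" "m < N"
  shows "(\<Sum>k<N. cis (2 * pi * real k / real N) ^ m) = 0"
proof -
  let ?w = "cis (2 * pi * real m / real N)"
  have "?w \<noteq> 1"
  proof
    assume "?w = 1"
    then have "cos (2 * pi * real m / real N) = 1"
      by (simp add: complex_eq_iff)
    then obtain i :: int where "2 * pi * real m / real N = of_int i * 2 * pi"
      by (auto simp: cos_one_2pi_int)
    then have "real m = of_int i * real N"
      using assms by (simp add: field_simps)
    then have "int m = i * int N"
      by (metis of_int_eq_iff of_int_mult of_int_of_nat_eq)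
    then have "int N dvd int m"
      by simp
    then show False
      using assms by (simp add: nat_dvd_not_less)
  qed
  moreover have "?w ^ N = 1"
  proof -
    have "?w ^ N = cis (real N * (2 * pi * real m / real N))"
      by (rule Complex.DeMoivre)
    also have "\<dots> = cis (2 * pi * real m)"
      using assms by simp
    finally show ?thesis
      by simp
  qed
  moreover have "cis (2 * pi * real k / real N) ^ m = ?w ^ k" for k
    by (simp add: Complex.DeMoivre mult_ac)
  ultimately show ?thesis
    by (simp add: geometric_sum)
qed

text \<open>The weight has only the Fourier modes -1, 0 and 1, so powers \<open>j >= 2\<close>
  average to zero; \<open>Suc j < N\<close> prevents the highest mode \<open>j + 1\<close> from
  aliasing to 0 on the grid.\<close>

lemma sum_Fejer_roots_of_unity:
  assumes "Suc j < N" "3 \<le> N"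
  defines "\<theta> \<equiv> \<lambda>k. 2 * pi * real k / real N"
  shows "(\<Sum>k<N. complex_of_real (1 + cos (\<theta> k)) * cis (\<theta> k) ^ j)
    = of_nat N * (if j = 0 then 1 else if j = 1 then 1 / 2 else 0)"
proof (cases j)
  case 0
  have "(\<Sum>k<N. complex_of_real (cos (\<theta> k))) = of_real (Re (\<Sum>k<N. cis (\<theta> k) ^ 1))"
    by simp
  also have "\<dots> = 0"
    unfolding \<theta>_def using assms by (subst sum_cis_roots_of_unity) auto
  finally show ?thesis
    using 0 by (simp add: sum.distrib)
next
  case (Suc i)
  have *: "complex_of_real (1 + cos (\<theta> k)) * cis (\<theta> k) ^ j
      = cis (\<theta> k) ^ j + (cis (\<theta> k) ^ Suc j + cis (\<theta> k) ^ i) / 2" for k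
  proof -
    have "cis (\<theta> k) * cis (- \<theta> k) = 1"
      by (simp add: cis_mult)
    moreover have "complex_of_real (cos (\<theta> k)) = (cis (\<theta> k) + cis (- \<theta> k)) / 2"
      by (simp add: complex_eq_iff)
    ultimately show ?thesis
      using Suc by (simp add: algebra_simps add_divide_distrib)
  qed
  have "(\<Sum>k<N. cis (\<theta> k) ^ j) = 0" "(\<Sum>k<N. cis (\<theta> k) ^ Suc j) = 0"
    unfolding \<theta>_def using assms Suc by (intro sum_cis_roots_of_unity; simp)+
  moreover have "(\<Sum>k<N. cis (\<theta> k) ^ i) = (if i = 0 then of_nat N else 0)"
    unfolding \<theta>_def using assms Suc by (auto intro: sum_cis_roots_of_unity)
  ultimately show ?thesis
    unfolding * using Suc by (simp add: sum.distrib flip: sum_divide_distrib)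
qed

text \<open>A convex combination of values of \<open>F\<close> on a circle has norm at most
  \<open>B\<close>, while the weights annihilate the higher coefficients of a partial sum and halve
  that of degree 1. Finite sums replace the integral, at the cost of a uniform error
  \<open>e\<close>.\<close>

lemma norm_first_coefficients_le:
  fixes F :: "complex \<Rightarrow> 'a::complex_normed_vector"
  assumes lim: "uniform_limit (cball 0 r) (\<lambda>n z. \<Sum>j<n. z ^ j *\<^sub>C a j) F sequentially"
    and bound: "\<And>z. cmod z \<le> r \<Longrightarrow> norm (F z) \<le> B"
    and w: "cmod w \<le> r"
  shows "norm (a 0 + (w / 2) *\<^sub>C a 1) \<le> B"
proof (rule field_le_epsilon)
  fix e :: real
  assume "0 < e"
  define P where "P = (\<lambda>n z. \<Sum>j<n. z ^ j *\<^sub>C a j)"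
  have "\<forall>\<^sub>F n in sequentially. \<forall>z\<in>cball 0 r. dist (P n z) (F z) < e"
    using uniform_limitD[OF lim \<open>0 < e\<close>] by (simp add: P_def)
  from eventually_happens'[OF _ eventually_conj[OF this eventually_ge_at_top[of 2]]]
  obtain n where n: "2 \<le> n" "\<And>z. cmod z \<le> r \<Longrightarrow> norm (P n z - F z) < e"
    by (auto simp: dist_norm)
  \<comment> \<open>One more node than there are coefficients, so that \<open>j < n\<close> gives
    \<open>Suc j < N\<close>; \<open>2 <= n\<close> keeps both surviving coefficients in
    \<open>P n\<close>.\<close>
  define N where "N = Suc n"
  define \<theta> where "\<theta> = (\<lambda>k. 2 * pi * real k / real N)"
  define v where "v = (\<lambda>k. (1 + cos (\<theta> k)) / real N)"
  have "0 < N" "3 \<le> N"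
    using n by (auto simp: N_def)
  have F: "(\<Sum>k<N. complex_of_real (v k) * cis (\<theta> k) ^ j)
      = (if j = 0 then 1 else if j = 1 then 1 / 2 else 0)" if "j < n" for j
  proof -
    have "(\<Sum>k<N. complex_of_real (v k) * cis (\<theta> k) ^ j)
      = (\<Sum>k<N. complex_of_real (1 + cos (\<theta> k)) * cis (\<theta> k) ^ j) / of_nat N"
      by (simp add: v_def sum_divide_distrib)
    then show ?thesis
      using sum_Fejer_roots_of_unity[of j N] that \<open>3 \<le> N\<close> \<open>0 < N\<close>
      unfolding \<theta>_def by (simp add: N_def del: sum.lessThan_Suc of_nat_Suc)
  qed
  \<comment> \<open>Nonnegative weights of total mass 1 (the moment \<open>j = 0\<close>) make the
    average a convex combination.\<close>
  have v: "0 \<le> v k" for k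
    unfolding v_def using cos_ge_minus_one[of "\<theta> k"] by (intro divide_nonneg_nonneg) linarith+
  have "complex_of_real (\<Sum>k<N. v k) = 1"
    using F[of 0] n by simp
  then have v1: "(\<Sum>k<N. v k) = 1"
    using of_real_eq_1_iff by blast
  have "(\<Sum>k<N. complex_of_real (v k) *\<^sub>C P n (w * cis (\<theta> k)))
      = (\<Sum>j<n. \<Sum>k<N. (w ^ j * (complex_of_real (v k) * cis (\<theta> k) ^ j)) *\<^sub>C a j)"
    unfolding P_def complex_vector.scale_sum_right
    by (subst sum.swap) (simp add: power_mult_distrib mult_ac)
  also have "\<dots> = (\<Sum>j<n. (w ^ j * (if j = 0 then 1 else if j = 1 then 1 / 2 else 0)) *\<^sub>C a j)"
    by (intro sum.cong refl)
      (simp only: F lessThan_iff flip: complex_vector.scale_sum_left sum_distrib_left)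
  also have "\<dots> = (\<Sum>j<2. (w ^ j * (if j = 0 then 1 else if j = 1 then 1 / 2 else 0)) *\<^sub>C a j)"
    using n by (intro sum.mono_neutral_right) auto
  also have "\<dots> = a 0 + (w / 2) *\<^sub>C a 1"
    by (simp add: numeral_2_eq_2)
  finally have "norm (a 0 + (w / 2) *\<^sub>C a 1)
      = norm (\<Sum>k<N. complex_of_real (v k) *\<^sub>C P n (w * cis (\<theta> k)))"
    by simp
  also have "\<dots> \<le> (\<Sum>k<N. v k * (B + e))"
  proof (rule sum_norm_le)
    fix k
    have z: "cmod (w * cis (\<theta> k)) \<le> r"
      using w by (simp add: norm_mult)
    have "norm (P n (w * cis (\<theta> k))) \<le> B + e"
      using n(2)[OF z] bound[OF z] norm_triangle_sub[of "P n (w * cis (\<theta> k))" "F (w * cis (\<theta> k))"]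
      by linarith
    then show "norm (complex_of_real (v k) *\<^sub>C P n (w * cis (\<theta> k))) \<le> v k * (B + e)"
      using v[of k] by (simp add: mult_left_mono)
  qed
  also have "\<dots> = B + e"
    by (simp add: v1 flip: sum_distrib_right)
  finally show "norm (a 0 + (w / 2) *\<^sub>C a 1) \<le> B + e" .
qed

subsection \<open>Norming functionals\<close>

definition sublinear :: "('a::real_vector \<Rightarrow> real) \<Rightarrow> bool"
  where "sublinear p \<longleftrightarrow> (\<forall>x y. p (x + y) \<le> p x + p y) \<and> (\<forall>c>0. \<forall>x. p (c *\<^sub>R x) = c * p x)"

lemma sublinear_zero:
  assumes "sublinear p"
  shows "p 0 = 0"
proof -
  have "p (2 *\<^sub>R 0) = 2 * p 0"
    using assms unfolding sublinear_def by (meson zero_less_numeral)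
  then show ?thesis
    by simp
qed

lemma sublinear_neg: "sublinear p \<Longrightarrow> - p (- x) \<le> p x"
  using sublinear_zero[of p] unfolding sublinear_def by (smt (verit) add.right_inverse)

text \<open>Lowers \<open>p\<close> in the direction of \<open>z\<close> as far as sublinearity allows.\<close>

definition sublinear_lower :: "('a::real_vector \<Rightarrow> real) \<Rightarrow> 'a \<Rightarrow> 'a \<Rightarrow> real"
  where "sublinear_lower p z x = (INF t\<in>{0..}. p (x + t *\<^sub>R z) - t * p z)"

text \<open>Writing \<open>t z = (x + t z) - x\<close> and using subadditivity gives a lower bound
  free of \<open>t\<close>, so the real infimum is meaningful.\<close>

lemma sublinear_lower_bdd:
  assumes "sublinear p"
  shows "bdd_below ((\<lambda>t. p (x + t *\<^sub>R z) - t * p z) ` {0..})"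
proof (rule bdd_belowI2)
  fix t :: real
  assume "t \<in> {0..}"
  have "p (t *\<^sub>R z) = t * p z"
    using assms \<open>t \<in> {0..}\<close> sublinear_zero[OF assms] unfolding sublinear_def
    by (cases "t = 0") auto
  moreover have "p (t *\<^sub>R z) \<le> p (x + t *\<^sub>R z) + p (- x)"
    using assms unfolding sublinear_def by (metis add.commute add_minus_cancel)
  ultimately show "- p (- x) \<le> p (x + t *\<^sub>R z) - t * p z"
    by linarith
qed

text \<open>With \<open>t = 0\<close> this puts the lowered functional below \<open>p\<close>; with
  \<open>t = 1\<close> it yields the inequality that makes a minimal functional
  superadditive.\<close>

lemma sublinear_lower_le:
  assumes "sublinear p" "0 \<le> t"
  shows "sublinear_lower p z x \<le> p (x + t *\<^sub>R z) - t * p z"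
  unfolding sublinear_lower_def
  using sublinear_lower_bdd[OF assms(1)] assms(2) by (intro cINF_lower) auto

text \<open>For subadditivity, parameters \<open>t\<close> for \<open>x\<close> and \<open>s\<close>
  for \<open>y\<close> combine to \<open>t + s\<close> for \<open>x + y\<close>; for homogeneity,
  the parameter is rescaled by \<open>c\<close>.\<close>

lemma sublinear_sublinear_lower:
  assumes p: "sublinear p"
  shows "sublinear (sublinear_lower p z)"
  unfolding sublinear_def
proof (intro conjI allI impI)
  let ?q = "sublinear_lower p z"
  have add: "p (x + y) \<le> p x + p y" for x y
    using p unfolding sublinear_def by auto
  fix x y
  have 1: "?q (x + y) - (p (y + s *\<^sub>R z) - s * p z) \<le> p (x + t *\<^sub>R z) - t * p z"
    if "0 \<le> s" "0 \<le> t" for s t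
  proof -
    have "?q (x + y) \<le> p (x + y + (t + s) *\<^sub>R z) - (t + s) * p z"
      using that by (intro sublinear_lower_le[OF p]) auto
    also have "x + y + (t + s) *\<^sub>R z = (x + t *\<^sub>R z) + (y + s *\<^sub>R z)"
      by (simp add: algebra_simps)
    finally show ?thesis
      using add[of "x + t *\<^sub>R z" "y + s *\<^sub>R z"] by (simp add: algebra_simps)
  qed
  have "?q (x + y) - (p (y + s *\<^sub>R z) - s * p z) \<le> ?q x" if "0 \<le> s" for s
    unfolding sublinear_lower_def[of p z x] using 1 that by (intro cINF_greatest) auto
  then have "?q (x + y) - ?q x \<le> p (y + s *\<^sub>R z) - s * p z" if "0 \<le> s" for s
    using that by (metis add.commute diff_le_eq)
  then have "?q (x + y) - ?q x \<le> ?q y"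
    unfolding sublinear_lower_def[of p z y] by (intro cINF_greatest) auto
  then show "?q (x + y) \<le> ?q x + ?q y"
    by simp
next
  let ?q = "sublinear_lower p z"
  have hom: "0 < c \<Longrightarrow> p (c *\<^sub>R x) = c * p x" for x c
    using p unfolding sublinear_def by auto
  have le: "?q (c *\<^sub>R x) \<le> c * ?q x" if "0 < c" for c x
  proof -
    have "?q (c *\<^sub>R x) / c \<le> p (x + t *\<^sub>R z) - t * p z" if "0 \<le> t" for t
    proof -
      have "?q (c *\<^sub>R x) \<le> p (c *\<^sub>R x + (c * t) *\<^sub>R z) - (c * t) * p z"
        using that \<open>0 < c\<close> by (intro sublinear_lower_le[OF p]) auto
      also have "\<dots> = c * (p (x + t *\<^sub>R z) - t * p z)"
        using hom[OF \<open>0 < c\<close>, of "x + t *\<^sub>R z"] by (simp add: algebra_simps)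
      finally show ?thesis
        using \<open>0 < c\<close> by (simp add: field_simps)
    qed
    then have "?q (c *\<^sub>R x) / c \<le> ?q x"
      unfolding sublinear_lower_def[of p z x] by (intro cINF_greatest) auto
    then show ?thesis
      using that by (simp add: field_simps)
  qed
  fix c :: real and x
  assume "0 < c"
  \<comment> \<open>The reverse inequality is the one already shown, for the factor
    \<open>inverse c\<close> at the point \<open>c *\<^sub>R x\<close>.\<close>
  have "c * ?q x \<le> ?q (c *\<^sub>R x)"
    using le[of "inverse c" "c *\<^sub>R x"] \<open>0 < c\<close> by (simp add: field_simps)
  then show "?q (c *\<^sub>R x) = c * ?q x"
    using le[OF \<open>0 < c\<close>, of x] by simp
qed

text \<open>The common majorant \<open>p0\<close> bounds all members from below by
  \<open>- p0 (- x)\<close>, so the infima exist. Subadditivity survives because two members of a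
  chain both lie above the smaller of them.\<close>

lemma sublinear_INF_chain:
  assumes ne: "C \<noteq> {}" and sub: "\<And>p. p \<in> C \<Longrightarrow> sublinear p"
    and chain: "\<And>p q. p \<in> C \<Longrightarrow> q \<in> C \<Longrightarrow> p \<le> q \<or> q \<le> p"
    and le: "\<And>p. p \<in> C \<Longrightarrow> p \<le> p0"
  shows "sublinear (\<lambda>x. INF p\<in>C. p x)" "p \<in> C \<Longrightarrow> (INF p\<in>C. p x) \<le> p x"
proof -
  have "- p0 (- x) \<le> p x" if "p \<in> C" for p x
    using sublinear_neg[OF sub[OF that], of x] le_funD[OF le[OF that], of "- x"] by linarith
  then have bdd: "bdd_below ((\<lambda>p. p x) ` C)" for x
    by (intro bdd_belowI2)
  show low: "(INF p\<in>C. p x) \<le> p x" if "p \<in> C" for p x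
    using bdd that by (rule cINF_lower)
  have add: "(INF p\<in>C. p (x + y)) \<le> (INF p\<in>C. p x) + (INF p\<in>C. p y)" for x y
  proof -
    have 1: "(INF p\<in>C. p (x + y)) - q y \<le> p x" if pq: "p \<in> C" "q \<in> C" for p q
    proof -
      obtain s where s: "s \<in> C" "s \<le> p" "s \<le> q"
        using chain[OF pq] pq by blast
      have "(INF p\<in>C. p (x + y)) \<le> s (x + y)"
        by (rule low[OF s(1)])
      also have "\<dots> \<le> s x + s y"
        using sub[OF s(1)] unfolding sublinear_def by blast
      finally show ?thesis
        using le_funD[OF s(2), of x] le_funD[OF s(3), of y] by linarith
    qed
    have "(INF p\<in>C. p (x + y)) - q y \<le> (INF p\<in>C. p x)" if "q \<in> C" for q
      using 1 that ne by (intro cINF_greatest) auto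
    then have "(INF p\<in>C. p (x + y)) - (INF p\<in>C. p x) \<le> q y" if "q \<in> C" for q
      using that by (metis add.commute diff_le_eq)
    then have "(INF p\<in>C. p (x + y)) - (INF p\<in>C. p x) \<le> (INF p\<in>C. p y)"
      using ne by (intro cINF_greatest) auto
    then show ?thesis
      by simp
  qed
  have hom: "(INF p\<in>C. p (c *\<^sub>R x)) \<le> c * (INF p\<in>C. p x)" if "0 < c" for c x
  proof -
    have "(INF p\<in>C. p (c *\<^sub>R x)) / c \<le> q x" if "q \<in> C" for q
      using low[OF that, of "c *\<^sub>R x"] sub[OF that] \<open>0 < c\<close>
      by (simp add: sublinear_def field_simps)
    then have "(INF p\<in>C. p (c *\<^sub>R x)) / c \<le> (INF p\<in>C. p x)"
      using ne by (intro cINF_greatest) auto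
    then show ?thesis
      using that by (simp add: field_simps)
  qed
  have "c * (INF p\<in>C. p x) \<le> (INF p\<in>C. p (c *\<^sub>R x))" if "0 < c" for c x
    using hom[of "inverse c" "c *\<^sub>R x"] that by (simp add: field_simps)
  then show "sublinear (\<lambda>x. INF p\<in>C. p x)"
    unfolding sublinear_def using add hom by (auto intro: antisym)
qed

text \<open>A minimal sublinear functional cannot be lowered in any direction, and this makes it linear.\<close>

lemma exists_linear_le_sublinear:
  fixes p0 :: "'a::real_vector \<Rightarrow> real"
  assumes p0: "sublinear p0"
  obtains f where "linear f" "f \<le> p0"
proof -
  define S where "S = {p. sublinear p \<and> p \<le> p0}"
  \<comment> \<open>With the order reversed, upper bounds in Zorn's lemma are lower bounds and a
    maximal element is a minimal functional.\<close>
  have "\<exists>m\<in>S. \<forall>a\<in>S. a \<le> m \<longrightarrow> a = m"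
  proof (rule predicate_Zorn[where P="\<lambda>a b. b \<le> a"])
    show "partial_order_on S (relation_of (\<lambda>a b. b \<le> a) S)"
      by (rule partial_order_on_relation_ofI) auto
    fix C
    assume "C \<in> Chains (relation_of (\<lambda>a b. b \<le> a) S)"
    then have C: "C \<subseteq> S" and chain: "\<And>p q. p \<in> C \<Longrightarrow> q \<in> C \<Longrightarrow> p \<le> q \<or> q \<le> p"
      by (auto simp: Chains_def relation_of_def)
    show "\<exists>u\<in>S. \<forall>a\<in>C. u \<le> a"
    proof (cases "C = {}")
      case True
      then show ?thesis
        using p0 by (auto simp: S_def)
    next
      case False
      have sub: "sublinear p" "p \<le> p0" if "p \<in> C" for p
        using that C by (auto simp: S_def)
      have low: "(\<lambda>x. INF p\<in>C. p x) \<le> p" if "p \<in> C" for p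
        using sublinear_INF_chain(2)[OF False sub(1) chain sub(2) that] by (simp add: le_fun_def)
      moreover have "sublinear (\<lambda>x. INF p\<in>C. p x)"
        using sublinear_INF_chain(1)[OF False sub(1) chain sub(2)] by simp
      moreover have "(\<lambda>x. INF p\<in>C. p x) \<le> p0"
        using False low sub(2) by (meson all_not_in_conv order_trans)
      ultimately show ?thesis
        by (auto simp: S_def)
    qed
  qed
  then obtain m where m: "sublinear m" "m \<le> p0"
    and min: "\<And>q. sublinear q \<Longrightarrow> q \<le> m \<Longrightarrow> q = m"
    unfolding S_def by (smt (verit) mem_Collect_eq order_trans)
  \<comment> \<open>The lowered functional is sublinear and, by \<open>t = 0\<close>, below
    \<open>m\<close>, so minimality identifies it with \<open>m\<close>.\<close>
  have low: "sublinear_lower m z = m" for z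
    using sublinear_lower_le[OF m(1), of 0 z]
    by (intro min sublinear_sublinear_lower m(1)) (simp add: le_fun_def)
  have "m x \<le> m (x + z) - m z" for x z
    using sublinear_lower_le[OF m(1), of 1 z x] by (simp add: low)
  then have add: "m (x + z) = m x + m z" for x z
    using m(1) unfolding sublinear_def by (smt (verit))
  have neg: "m (- x) = - m x" for x
    using add[of x "- x"] sublinear_zero[OF m(1)] by simp
  have "m (c *\<^sub>R x) = c * m x" for c x
  proof (cases c "0::real" rule: linorder_cases)
    case less
    then have "m ((- c) *\<^sub>R x) = (- c) * m x"
      using m(1) unfolding sublinear_def by (metis neg_0_less_iff_less)
    then show ?thesis
      by (simp add: neg)
  qed (use m(1) sublinear_zero[OF m(1)] in \<open>auto simp: sublinear_def\<close>)
  then have "linear m"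
    using add by (intro linearI) auto
  then show thesis
    using that m(2) by blast
qed

text \<open>Dominating a real functional by the norm lowered in the direction \<open>y\<close>,
  rather than by the norm itself, forces it to reach \<open>norm y\<close> at \<open>y\<close>; it
  is then complexified.\<close>

lemma exists_norming_functional:
  fixes y :: "'a::complex_normed_vector"
  obtains f :: "'a \<Rightarrow> complex"
  where "bounded_clinear f" "\<And>x. cmod (f x) \<le> norm x" "norm y \<le> cmod (f y)"
proof -
  have norm: "sublinear (norm :: 'a \<Rightarrow> real)"
    by (simp add: sublinear_def norm_triangle_ineq)
  from exists_linear_le_sublinear[OF sublinear_sublinear_lower[OF this, of y]]
  obtain p :: "'a \<Rightarrow> real" where p: "linear p" "p \<le> sublinear_lower norm y"
    by blast
  have le: "p x \<le> norm x" for x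
    using le_funD[OF p(2), of x] sublinear_lower_le[OF norm, of 0 y x] by simp
  have "p (- y) \<le> - norm y"
    using le_funD[OF p(2), of "- y"] sublinear_lower_le[OF norm, of 1 y "- y"] by simp
  then have y: "norm y \<le> p y"
    by (simp add: linear_neg[OF p(1)])
  \<comment> \<open>The only complex linear functional with real part \<open>p\<close>.\<close>
  define f where "f = (\<lambda>x. Complex (p x) (- p (\<i> *\<^sub>C x)))"
  have add: "f (x + z) = f x + f z" for x z
    by (simp add: f_def complex_eq_iff scaleC_add_right linear_add[OF p(1)])
  have scR: "p (complex_of_real r *\<^sub>C x) = r * p x" for r x
    using linear_scale[OF p(1), of r x] by (simp add: scaleR_eq_scaleC)
  have scale: "f (c *\<^sub>C x) = c * f x" for c x
  proof -
    have 1: "p (c *\<^sub>C x) = Re c * p x + Im c * p (\<i> *\<^sub>C x)" for c x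
    proof -
      have "c *\<^sub>C x = complex_of_real (Re c) *\<^sub>C x + complex_of_real (Im c) *\<^sub>C \<i> *\<^sub>C x"
        by (simp add: complex_eq mult.commute flip: scaleC_add_left)
      then show ?thesis
        by (simp only: linear_add[OF p(1)] scR)
    qed
    show ?thesis
      unfolding f_def scaleC_scaleC 1[of c] 1[of "\<i> * c"] by (simp add: complex_eq_iff)
  qed
  have bound: "cmod (f x) \<le> norm x" for x
  proof (cases "f x = 0")
    case False
    \<comment> \<open>A unimodular factor that rotates \<open>f x\<close> to a positive real, so
      that the bound on the real part \<open>p\<close> bounds the modulus.\<close>
    define c where "c = cnj (f x) / of_real (cmod (f x))"
    have "c * f x = of_real (cmod (f x))"
      using False by (simp add: c_def field_simps complex_norm_square[symmetric] power2_eq_square)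
    then have "f (c *\<^sub>C x) = of_real (cmod (f x))"
      by (simp add: scale)
    then have "p (c *\<^sub>C x) = cmod (f x)"
      by (simp add: f_def complex_eq_iff)
    moreover have "cmod c = 1"
      using False by (simp add: c_def norm_divide)
    ultimately show ?thesis
      using le[of "c *\<^sub>C x"] by simp
  qed simp
  have "bounded_linear f"
    using add bound by (intro bounded_linear_intro[where K=1])
      (auto simp: scaleR_eq_scaleC scale scaleR_conv_of_real)
  then have "bounded_clinear f"
    by (simp add: bounded_clinear_def scale)
  moreover have "norm y \<le> cmod (f y)"
    using y abs_Re_le_cmod[of "f y"] by (simp add: f_def)
  ultimately show thesis
    using that bound by blast
qed

subsection \<open>Resolvents\<close>

lemma
  assumes "z \<in> resolvent_set D A"
  shows resolvent_bounded_clinear: "bounded_clinear (resolvent D A z)"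
    and resolvent_in_domain: "resolvent D A z x \<in> D"
    and resolvent_right: "A (resolvent D A z x) - z *\<^sub>C resolvent D A z x = x"
    and resolvent_left: "u \<in> D \<Longrightarrow> resolvent D A z (A u - z *\<^sub>C u) = u"
proof -
  have bij: "bij_betw (\<lambda>x. A x - z *\<^sub>C x) D UNIV"
    using assms by (simp add: resolvent_set_def)
  then have im: "(\<lambda>x. A x - z *\<^sub>C x) ` D = UNIV" and inj: "inj_on (\<lambda>x. A x - z *\<^sub>C x) D"
    by (simp_all add: bij_betw_def)
  show "bounded_clinear (resolvent D A z)"
    using assms by (simp add: resolvent_set_def)
  show "resolvent D A z x \<in> D"
    unfolding resolvent_def using im by (intro inv_into_into) simp
  show "A (resolvent D A z x) - z *\<^sub>C resolvent D A z x = x"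
    unfolding resolvent_def using im f_inv_into_f[of x "\<lambda>x. A x - z *\<^sub>C x" D] by simp
  show "u \<in> D \<Longrightarrow> resolvent D A z (A u - z *\<^sub>C u) = u"
    unfolding resolvent_def using inv_into_f_f[OF inj] by simp
qed

text \<open>The resolvent identity: with \<open>u\<close> the left side,
  \<open>(A - z0) u = x + z u\<close>, and the resolvent at \<open>z0\<close> is applied to both
  sides.\<close>

lemma resolvent_shift:
  assumes z0: "z0 \<in> resolvent_set D A" and z: "z0 + z \<in> resolvent_set D A"
  shows "resolvent D A (z0 + z) x
    = resolvent D A z0 x + z *\<^sub>C resolvent D A z0 (resolvent D A (z0 + z) x)"
proof -
  let ?T = "resolvent D A z0" and ?u = "resolvent D A (z0 + z) x"
  have T: "bounded_linear ?T" "?T (c *\<^sub>C v) = c *\<^sub>C ?T v" for c v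
    using resolvent_bounded_clinear[OF z0] by (auto simp: bounded_clinear_def)
  have "A ?u - z0 *\<^sub>C ?u = x + z *\<^sub>C ?u"
    using resolvent_right[OF z, of x] by (simp add: scaleC_add_left algebra_simps)
  then have "?u = ?T (x + z *\<^sub>C ?u)"
    using resolvent_left[OF z0 resolvent_in_domain[OF z], of x] by simp
  then show ?thesis
    by (simp add: linear_add[OF bounded_linear.linear[OF T(1)]] T(2))
qed

text \<open>Iterating the resolvent identity gives an exact remainder. The exponent
  \<open>Suc j\<close> appears because the expansion starts with the resolvent at \<open>z0\<close>,
  not with the identity.\<close>

lemma resolvent_Neumann_remainder:
  assumes z0: "z0 \<in> resolvent_set D A" and z: "z0 + z \<in> resolvent_set D A"
  shows "resolvent D A (z0 + z) x - (\<Sum>j<n. z ^ j *\<^sub>C (resolvent D A z0 ^^ Suc j) x)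
    = z ^ n *\<^sub>C (resolvent D A z0 ^^ n) (resolvent D A (z0 + z) x)"
proof (induction n)
  case (Suc n)
  let ?T = "resolvent D A z0" and ?u = "resolvent D A (z0 + z) x"
  have T: "bounded_linear ?T" "?T (c *\<^sub>C v) = c *\<^sub>C ?T v" for c v
    using resolvent_bounded_clinear[OF z0] by (auto simp: bounded_clinear_def)
  have pow: "(?T ^^ n) (a + c *\<^sub>C b) = (?T ^^ n) a + c *\<^sub>C (?T ^^ n) b" for a b c
    by (induction n) (simp_all add: linear_add[OF bounded_linear.linear[OF T(1)]] T(2))
  have "(?T ^^ n) ?u = (?T ^^ n) (?T x + z *\<^sub>C ?T ?u)"
    using resolvent_shift[OF z0 z, of x] by simp
  also have "\<dots> = (?T ^^ Suc n) x + z *\<^sub>C (?T ^^ Suc n) ?u"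
    by (simp only: pow funpow_Suc_right o_apply)
  finally have "z ^ n *\<^sub>C (?T ^^ n) ?u
      = z ^ n *\<^sub>C (?T ^^ Suc n) x + z ^ Suc n *\<^sub>C (?T ^^ Suc n) ?u"
    by (simp add: scaleC_add_right mult.commute del: funpow.simps)
  then show ?case
    using Suc by (simp add: algebra_simps del: funpow.simps)
qed simp

lemma norm_funpow_le:
  fixes T :: "'a::real_normed_vector \<Rightarrow> 'a"
  assumes "\<And>x. norm (T x) \<le> M * norm x" "0 \<le> M"
  shows "norm ((T ^^ n) x) \<le> M ^ n * norm x"
proof (induction n)
  case (Suc n)
  have "norm ((T ^^ Suc n) x) \<le> M * norm ((T ^^ n) x)"
    using assms(1) by simp
  also have "\<dots> \<le> M * (M ^ n * norm x)"
    using Suc assms(2) by (rule mult_left_mono)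
  finally show ?case
    by (simp add: mult.assoc)
qed simp

text \<open>The Neumann remainder is at most \<open>(r * M) ^ n * (M * norm x)\<close> on the whole
  disc, so convergence is uniform there and the averaging estimate applies to the first two
  coefficients.\<close>

lemma norm_resolvent_perturbed_le:
  fixes D :: "'a::complex_normed_vector set"
  assumes bound: "\<And>z x. cmod z \<le> r \<Longrightarrow>
      z0 + z \<in> resolvent_set D A \<and> norm (resolvent D A (z0 + z) x) \<le> M * norm x"
    and r: "0 \<le> r" "r * M < 1" and M: "0 \<le> M" and w: "cmod w \<le> r"
  shows "norm (resolvent D A z0 x + (w / 2) *\<^sub>C resolvent D A z0 (resolvent D A z0 x))
    \<le> M * norm x"
proof -
  let ?T = "resolvent D A z0"
  have z0: "z0 \<in> resolvent_set D A" and T: "norm (?T x) \<le> M * norm x" for x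
    using bound[of 0] r by auto
  have "uniform_limit (cball 0 r) (\<lambda>n z. \<Sum>j<n. z ^ j *\<^sub>C (?T ^^ Suc j) x)
      (\<lambda>z. resolvent D A (z0 + z) x) sequentially"
  proof (rule uniform_limitI)
    fix e :: real
    assume "0 < e"
    have "(\<lambda>n. (r * M) ^ n * (M * norm x)) \<longlonglongrightarrow> 0 * (M * norm x)"
      using r M by (intro tendsto_intros LIMSEQ_power_zero) (simp add: abs_mult)
    then have "\<forall>\<^sub>F n in sequentially. (r * M) ^ n * (M * norm x) < e"
      using \<open>0 < e\<close> by (intro order_tendstoD(2)) auto
    then show "\<forall>\<^sub>F n in sequentially. \<forall>z\<in>cball 0 r.
        dist (\<Sum>j<n. z ^ j *\<^sub>C (?T ^^ Suc j) x) (resolvent D A (z0 + z) x) < e"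
    proof (rule eventually_mono, intro ballI)
      fix n z
      assume e: "(r * M) ^ n * (M * norm x) < e" and "z \<in> cball (0 :: complex) r"
      then have z: "cmod z \<le> r"
        by simp
      have "norm ((?T ^^ n) (resolvent D A (z0 + z) x)) \<le> M ^ n * norm (resolvent D A (z0 + z) x)"
        using T M by (rule norm_funpow_le)
      also have "\<dots> \<le> M ^ n * (M * norm x)"
        using bound[OF z] M by (intro mult_left_mono) auto
      finally have "cmod z ^ n * norm ((?T ^^ n) (resolvent D A (z0 + z) x))
          \<le> r ^ n * (M ^ n * (M * norm x))"
        using z by (intro mult_mono power_mono) (use r in auto)
      then have "norm (resolvent D A (z0 + z) x - (\<Sum>j<n. z ^ j *\<^sub>C (?T ^^ Suc j) x))
          \<le> (r * M) ^ n * (M * norm x)"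
        using resolvent_Neumann_remainder[OF z0, of z x n] bound[OF z]
        by (simp add: norm_power power_mult_distrib mult.assoc del: funpow.simps)
      then show "dist (\<Sum>j<n. z ^ j *\<^sub>C (?T ^^ Suc j) x) (resolvent D A (z0 + z) x) < e"
        using e by (simp add: dist_norm norm_minus_commute del: funpow.simps)
    qed
  qed
  from norm_first_coefficients_le[OF this _ w] bound show ?thesis
    by auto
qed

subsection \<open>Complex strict convexity\<close>

text \<open>The norm attains its maximum on the compact closure. The maximiser need not be the image
  of a point of the unit ball, so later estimates must pass to limits.\<close>

lemma onorm_attained_in_closure:
  fixes T :: "'a::complex_normed_vector \<Rightarrow> 'b::complex_normed_vector"
  assumes "compact_operator T"
  obtains y where "y \<in> closure (T ` cball 0 1)" "onorm T \<le> norm y"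
proof -
  let ?K = "closure (T ` cball 0 1)"
  have T: "bounded_linear T" and K: "compact ?K"
    using assms by (auto simp: compact_operator_def bounded_clinear_def)
  have sub: "T ` cball 0 1 \<subseteq> ?K"
    by (rule closure_subset)
  have "?K \<noteq> {}"
    by simp
  then obtain y where y: "y \<in> ?K" "\<And>u. u \<in> ?K \<Longrightarrow> norm u \<le> norm y"
    using continuous_attains_sup[OF K, of norm] by (auto intro: continuous_intros)
  have "norm (T x) \<le> norm y * norm x" for x
  proof (cases "x = 0")
    case True
    then show ?thesis
      using linear_0[OF bounded_linear.linear[OF T]] by simp
  next
    case False
    then have "norm (T (inverse (norm x) *\<^sub>R x)) \<le> norm y"
      by (intro y(2) subsetD[OF sub] imageI) simp
    then show ?thesis
      using False by (simp add: linear_scale[OF bounded_linear.linear[OF T]] field_simps)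
  qed
  then have "onorm T \<le> norm y"
    by (intro onorm_bound) auto
  then show thesis
    using that y(1) by blast
qed

section \<open>Functionals as elements of the complex dual, and strict convexity on scaled
  spheres\<close>

lemma bounded_clinear_compose:
  "bounded_clinear f \<Longrightarrow> bounded_clinear g \<Longrightarrow> bounded_clinear (\<lambda>x. f (g x))"
  by (simp add: bounded_clinear_def bounded_linear_compose)

lemma blinfun_of_Cdual:
  assumes "bounded_clinear f"
  shows "blinfun_apply (blinfun_of_cdual (Cdual (Blinfun f))) = f"
proof -
  have "blinfun_apply (Blinfun f) = f"
    using assms by (simp add: bounded_clinear_def bounded_linear_Blinfun_apply)
  then show ?thesis
    using assms by (simp add: Cdual_inverse)
qed

lemma norm_cdual_le:
  assumes "\<And>x. cmod (blinfun_apply (blinfun_of_cdual g) x) \<le> b * norm x" "0 \<le> b"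
  shows "norm g \<le> b"
  unfolding norm_cdual.rep_eq using assms by (intro norm_blinfun_bound) auto

lemma cdual_add_scaleC_apply:
  "blinfun_apply (blinfun_of_cdual (f + c *\<^sub>C g)) x
    = blinfun_apply (blinfun_of_cdual f) x + c * blinfun_apply (blinfun_of_cdual g) x"
  by (simp add: plus_cdual.rep_eq scaleC_cdual.rep_eq blinfun.add_left
      bounded_linear_Blinfun_apply bounded_linear_intros)

text \<open>Dividing by \<open>M\<close> moves \<open>x\<close> to the unit sphere, and absorbing
  the factor \<open>r\<close> into \<open>y\<close> turns the disc of radius \<open>r\<close> into
  the unit disc.\<close>

lemma complex_strictly_convex_scaled:
  fixes x y :: "'a::complex_banach"
  assumes "complex_strictly_convex TYPE('a)" and x: "M \<le> norm x" "0 < M" and r: "0 < r"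
    and le: "\<And>w. cmod w \<le> r \<Longrightarrow> norm (x + w *\<^sub>C y) \<le> M"
  shows "y = 0"
proof -
  let ?c = "complex_of_real (inverse M)"
  have c: "cmod ?c = inverse M"
    using x by (simp only: norm_of_real abs_of_pos positive_imp_inverse_positive)
  \<comment> \<open>The case \<open>w = 0\<close> supplies the upper bound.\<close>
  have "norm x = M"
    using le[of 0] x r by simp
  then have "norm (?c *\<^sub>C x) = 1"
    using x by (simp add: norm_inverse)
  moreover have "norm (?c *\<^sub>C x + \<zeta> *\<^sub>C (?c * complex_of_real r) *\<^sub>C y) \<le> 1"
    if "cmod \<zeta> \<le> 1" for \<zeta>
  proof -
    have "cmod (\<zeta> * complex_of_real r) \<le> r"
      using that r by (simp add: norm_mult)
    from le[OF this] have "norm (?c *\<^sub>C (x + (\<zeta> * complex_of_real r) *\<^sub>C y)) \<le> 1"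
      unfolding norm_scaleC c using x by (simp add: field_simps)
    then show ?thesis
      by (simp only: scaleC_add_right scaleC_scaleC mult_ac)
  qed
  ultimately have "(?c * complex_of_real r) *\<^sub>C y = 0"
    using assms(1) unfolding complex_strictly_convex_def by blast
  then show ?thesis
    using x r by simp
qed

text \<open>The perturbation bound defines a closed set, so it passes from the image of the unit
  ball to the maximal point \<open>y\<close>; strict convexity and injectivity then force
  \<open>y = 0\<close>, against \<open>M > 0\<close>.\<close>

lemma onorm_less_bound_if_strictly_convex:
  fixes T :: "'a::complex_banach \<Rightarrow> 'a"
  assumes convex: "complex_strictly_convex TYPE('a)"
    and T: "compact_operator T" and inj: "\<And>x. T x = 0 \<Longrightarrow> x = 0" and M: "0 < M" and r: "0 < r"
    and le: "\<And>w x. cmod w \<le> r \<Longrightarrow> norm (T x + w *\<^sub>C T (T x)) \<le> M * norm x"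
  shows "onorm T < M"
proof (rule ccontr)
  assume "\<not> onorm T < M"
  moreover obtain y where "y \<in> closure (T ` cball 0 1)" "onorm T \<le> norm y"
    by (rule onorm_attained_in_closure[OF T])
  ultimately have y: "y \<in> closure (T ` cball 0 1)" "M \<le> norm y"
    by auto
  have "bounded_linear T"
    using T by (simp add: compact_operator_def bounded_clinear_def)
  then have cont: "continuous_on UNIV (\<lambda>u. norm (u + w *\<^sub>C T u))" for w
    by (intro continuous_intros linear_continuous_on bounded_linear_compose[OF bounded_linear_scaleC])
  have "norm (y + w *\<^sub>C T y) \<le> M" if "cmod w \<le> r" for w
  proof -
    have "closed {u. norm (u + w *\<^sub>C T u) \<le> M}"
      by (intro closed_Collect_le cont continuous_on_const)
    moreover have "norm (T x + w *\<^sub>C T (T x)) \<le> M" if "norm x \<le> 1" for x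
      using le[OF \<open>cmod w \<le> r\<close>, of x] that M mult_left_mono[of "norm x" 1 M] by linarith
    then have "T ` cball 0 1 \<subseteq> {u. norm (u + w *\<^sub>C T u) \<le> M}"
      by auto
    ultimately show ?thesis
      using y(1) closure_minimal by blast
  qed
  then have "T y = 0"
    by (rule complex_strictly_convex_scaled[OF convex y(2) M r])
  then show False
    using inj y(2) M by fastforce
qed

text \<open>A functional \<open>f\<close> norming a maximal point of the closed image of the unit ball makes
  \<open>f \<circ> T\<close> attain the norm of the adjoint, so compactness of the adjoint is not needed.\<close>

lemma onorm_less_bound_if_dual_strictly_convex:
  fixes T :: "'a::complex_banach \<Rightarrow> 'a"
  assumes convex: "complex_strictly_convex TYPE('a cdual)"
    and T: "compact_operator T" and dense: "closure (range T) = UNIV" and M: "0 < M" and r: "0 < r"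
    and le: "\<And>w x. cmod w \<le> r \<Longrightarrow> norm (T x + w *\<^sub>C T (T x)) \<le> M * norm x"
  shows "onorm T < M"
proof (rule ccontr)
  assume "\<not> onorm T < M"
  moreover obtain y where "y \<in> closure (T ` cball 0 1)" "onorm T \<le> norm y"
    by (rule onorm_attained_in_closure[OF T])
  ultimately have y: "y \<in> closure (T ` cball 0 1)" "M \<le> norm y"
    by auto
  obtain f :: "'a \<Rightarrow> complex"
    where f: "bounded_clinear f" "\<And>x. cmod (f x) \<le> norm x" "norm y \<le> cmod (f y)"
    using exists_norming_functional[of y] by blast
  have Tc: "bounded_clinear T"
    using T by (simp add: compact_operator_def)
  \<comment> \<open>\<open>g\<close> and \<open>h\<close> are the images of \<open>f\<close> under
    the adjoint of \<open>T\<close> and under its square.\<close>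
  define g where "g = Cdual (Blinfun (\<lambda>x. f (T x)))"
  define h where "h = Cdual (Blinfun (\<lambda>x. f (T (T x))))"
  have g: "blinfun_apply (blinfun_of_cdual g) = (\<lambda>x. f (T x))"
    unfolding g_def by (intro blinfun_of_Cdual bounded_clinear_compose[OF f(1)] Tc)
  have h: "blinfun_apply (blinfun_of_cdual h) = (\<lambda>x. f (T (T x)))"
    unfolding h_def by (intro blinfun_of_Cdual bounded_clinear_compose[OF f(1)]
        bounded_clinear_compose[OF Tc] Tc)
  have lin: "bounded_linear f" "bounded_linear T" "f (a + c *\<^sub>C b) = f a + c * f b" for a b c
    using f(1) Tc by (auto simp: bounded_clinear_def linear_add[OF bounded_linear.linear])
  \<comment> \<open>\<open>f y\<close> is a limit of values \<open>f (T x)\<close> with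
    \<open>norm x <= 1\<close>, each bounded by the norm of \<open>g\<close>.\<close>
  have "cmod (f y) \<le> norm g"
  proof -
    have "closed {u. cmod (f u) \<le> norm g}"
      by (intro closed_Collect_le continuous_intros linear_continuous_on lin(1))
    moreover have "cmod (f (T x)) \<le> norm g" if "norm x \<le> 1" for x
      using norm_blinfun[of "blinfun_of_cdual g" x] that mult_left_mono[of "norm x" 1 "norm g"]
      by (simp add: g norm_cdual.rep_eq)
    then have "T ` cball 0 1 \<subseteq> {u. cmod (f u) \<le> norm g}"
      by auto
    ultimately show ?thesis
      using y(1) closure_minimal by blast
  qed
  then have "M \<le> norm g"
    using f(3) y(2) by linarith
  \<comment> \<open>Since \<open>f\<close> has norm at most 1, the vector estimate transfers to the
    dual at each \<open>x\<close>.\<close>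
  moreover have "norm (g + w *\<^sub>C h) \<le> M" if "cmod w \<le> r" for w
  proof (rule norm_cdual_le)
    fix x
    have "cmod (f (T x + w *\<^sub>C T (T x))) \<le> M * norm x"
      using f(2) le[OF that] by (rule order_trans)
    then show "cmod (blinfun_apply (blinfun_of_cdual (g + w *\<^sub>C h)) x) \<le> M * norm x"
      by (simp add: cdual_add_scaleC_apply g h lin(3))
  qed (use M in simp)
  ultimately have "h = 0"
    using complex_strictly_convex_scaled[OF convex _ M r] by blast
  then have "f (T (T x)) = 0" for x
    using fun_cong[OF h, of x] by (simp add: zero_cdual.rep_eq)
  \<comment> \<open>Used for \<open>f\<close> composed with \<open>T\<close> and then for
    \<open>f\<close>: the dense range removes one factor \<open>T\<close> each time.\<close>
  moreover have vanish: "F u = 0" if "bounded_linear F" "\<And>x. F (T x) = 0" for F :: "'a \<Rightarrow> complex" and u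
  proof -
    have "closed {u. F u = 0}"
      by (intro closed_Collect_eq linear_continuous_on that(1) continuous_on_const)
    moreover have "range T \<subseteq> {u. F u = 0}"
      using that(2) by auto
    ultimately show ?thesis
      using dense closure_minimal by blast
  qed
  ultimately have "f (T x) = 0" for x
    using vanish[OF bounded_linear_compose[OF lin(1,2)]] by blast
  then have "f y = 0"
    using vanish[OF lin(1)] by blast
  then show False
    using f(3) y(2) M by simp
qed

section \<open>Strictness of the resolvent bound on an open set\<close>

theorem theorem2p2:
  fixes D :: "'a::complex_banach set"
    and A :: "'a \<Rightarrow> 'a"
    and \<Omega> :: "complex set"
    and M :: real
  assumes nonzero: "\<exists>x::'a. x \<noteq> 0"
    and convex: "complex_strictly_convex TYPE('a) \<or> complex_strictly_convex TYPE('a cdual)"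
    and closed: "closed_operator D A"
    and dense: "densely_defined D"
    and compact_resolvent: "has_compact_resolvent D A"
    and open_\<Omega>: "open \<Omega>"
    and \<Omega>_subset: "\<Omega> \<subseteq> resolvent_set D A"
    and bound: "\<forall>z\<in>\<Omega>. onorm (resolvent D A z) \<le> M"
  shows "\<forall>z\<in>\<Omega>. onorm (resolvent D A z) < M"
proof
  fix z0
  assume z0: "z0 \<in> \<Omega>"
  let ?T = "resolvent D A z0"
  have res: "z0 \<in> resolvent_set D A"
    using z0 \<Omega>_subset by blast
  have T: "compact_operator ?T"
    using compact_resolvent res by (simp add: has_compact_resolvent_def)
  have lin: "clinear_operator D A"
    using closed by (simp add: closed_operator_def)
  have "0 \<in> D"
    using lin complex_vector.subspace_0 by (auto simp: clinear_operator_def)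
  \<comment> \<open>If \<open>?T x = 0\<close>, the equation solved by the resolvent reduces to
    \<open>x = A 0\<close>, so this value decides injectivity.\<close>
  then have "A 0 = 0"
    using lin unfolding clinear_operator_def by (metis complex_vector.scale_zero_left)
  then have inj: "x = 0" if "?T x = 0" for x
    using resolvent_right[OF res, of x] that by simp
  have bl: "bounded_linear (resolvent D A z)" if "z \<in> \<Omega>" for z
    using resolvent_bounded_clinear[of z D A] that \<Omega>_subset by (auto simp: bounded_clinear_def)
  obtain x0 :: 'a where "x0 \<noteq> 0"
    using nonzero by blast
  \<comment> \<open>An injective operator on a nonzero space is nonzero, which makes
    \<open>M\<close> positive.\<close>
  then have "onorm ?T \<noteq> 0"
    using inj onorm_eq_0[OF bl[OF z0]] by blast
  then have M: "0 < M"
    using onorm_pos_le[OF bl[OF z0]] bound z0 by force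
  obtain e where e: "0 < e" "cball z0 e \<subseteq> \<Omega>"
    using open_\<Omega> z0 open_contains_cball by blast
  \<comment> \<open>The radius \<open>e\<close> keeps the disc inside \<open>\<Omega>\<close>; the
    second bound gives \<open>r * M <= 1 / 2\<close>, so the Neumann series converges.\<close>
  define r where "r = min e (inverse (2 * M))"
  have r: "0 < r" "r \<le> e"
    using e M by (auto simp: r_def)
  have "r * M \<le> inverse (2 * M) * M"
    using M by (intro mult_right_mono) (auto simp: r_def)
  then have rM: "r * M < 1"
    using M by simp
  have le: "norm (?T x + (w / 2) *\<^sub>C ?T (?T x)) \<le> M * norm x" if "cmod w \<le> r" for w x
  proof (rule norm_resolvent_perturbed_le[where r=r])
    fix z x
    assume "cmod z \<le> r"
    then have z: "z0 + z \<in> \<Omega>"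
      using e r by (intro subsetD[OF e(2)]) (simp add: dist_norm)
    have "norm (resolvent D A (z0 + z) x) \<le> onorm (resolvent D A (z0 + z)) * norm x"
      by (rule onorm[OF bl[OF z]])
    also have "\<dots> \<le> M * norm x"
      using bound z by (intro mult_right_mono) auto
    finally show "z0 + z \<in> resolvent_set D A \<and> norm (resolvent D A (z0 + z) x) \<le> M * norm x"
      using z \<Omega>_subset by blast
  qed (use r rM M that in auto)
  \<comment> \<open>Substituting \<open>2 * w\<close> removes the factor 1/2 left by the averaging,
    at the price of halving the radius.\<close>
  have le': "norm (?T x + w *\<^sub>C ?T (?T x)) \<le> M * norm x" if "cmod w \<le> r / 2" for w x
    using le[of "2 * w" x] that by (simp add: norm_mult)
  \<comment> \<open>Each \<open>u\<close> in \<open>D\<close> is the resolvent applied to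
    \<open>A u - z0 *\<^sub>C u\<close>, so the density of the domain passes to the range.\<close>
  have "D \<subseteq> range ?T"
    using resolvent_left[OF res] by (metis rangeI subsetI)
  then have "closure (range ?T) = UNIV"
    using dense closure_mono unfolding densely_defined_def by blast
  moreover have "0 < r / 2"
    using r(1) by simp
  ultimately show "onorm ?T < M"
    using convex onorm_less_bound_if_strictly_convex[OF _ T inj M _ le']
      onorm_less_bound_if_dual_strictly_convex[OF _ T _ M _ le'] by blast
qed

end
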